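(* Let $X=\{a,b,c\}$ and let $S$ be the semigroup with presentation $\langle a,b,c \mid abcc=cba\rangle$. This presentation satisfies condition $K_3^2$ and its defining relation satisfies $\|abcc\|+\|cba\|\geq 7$. However, no automatic structure $L\subseteq X^*$ for $S$ over the generating set $X$ consists only of geodesics; in particular, the set of all geodesics in $X^*$ is not an automatic structure for $S$.
   Context: All semigroups are taken with an identity $1$, represented by the empty word $\varepsilon$; $S$ is the monoid generated by $X$ subject to the given relation. $X^*$ is the set of all words over $X$, $|W|$ is the length of $W$, and $\overline{W}\in S$ is the element represented by $W$. A word $W\in X^*$ is a geodesic if $|W|\leq |U|$ for every $U\in X^*$ with $\overline{U}=\overline{W}$. For a presentation $\langle X\mid L_1=R_1,\ldots,L_n=R_n\rangle$, the defining words are the $L_i$ and $R_i$. A piece is a word $P$ such that there are defining words $W_1,W_2$ (possibly equal) with $W_1=U_1PU_2$, $W_2=V_1PV_2$ and either $U_1\neq V_1$ or $U_2\neq V_2$. The piece-length $\|W\|$ is the minimal $k$ such that $W=P_1\cdots P_k$ with all $P_i$ pieces ($\|\varepsilon\|=0$, and $\|W\|=\infty$ if there is no such decomposition). Condition $K_3^2$: (a) for each defining relation $L=R$, $L$ and $R$ start with different generators and end with different generators; (b) each defining word $W$ has $\|W\|\geq 3$; (c) if $R_1=L_1$ and $R_2=L_2$ are two defining relations then $R_1,L_1,R_2,L_2$ are distinct. Let $\$\notin X$ and $X(2,\$)=((X\cup\{\$\})\times(X\cup\{\$\}))\setminus\{(\$,\$)\}$. For $W=x_1\cdots x_n$, $U=y_1\cdots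 y_m$ in $X^*$, $(W,U)\delta_X\in X(2,\$)^*$ is the word of pairs $(x_1,y_1)(x_2,y_2)\cdots$ obtained after padding the shorter word on the right with $\$$'s. An automatic structure for $S$ over $X$ is a regular language $L\subseteq X^*$ such that $L$ maps onto $S$ under $W\mapsto\overline{W}$ and for every $x\in X\cup\{\varepsilon\}$ the set $\{(W,U)\delta_X : W,U\in L,\ \overline{Wx}=\overline{U}\}$ is regular. *)

theory Defs
  imports "HOL-Algebra.Group" "HOL-Library.Extended_Nat"
begin

text \<open>
  The generating set \<open>X\<close> is the whole type \<^typ>\<open>'a\<close>, so \<open>X\<^sup>*\<close> is \<^typ>\<open>'a list\<close>.
  A finite presentation is the list of its defining relations \<open>(L\<^sub>i, R\<^sub>i)\<close>.
\<close>

type_synonym 'a presentation = "('a list \<times> 'a list) list"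

inductive_set word_cong :: "'a presentation \<Rightarrow> ('a list \<times> 'a list) set"
  for P :: "'a presentation" where
  base: "(L, R) \<in> set P \<Longrightarrow> (L, R) \<in> word_cong P"
| refl: "(W, W) \<in> word_cong P"
| sym: "(W, U) \<in> word_cong P \<Longrightarrow> (U, W) \<in> word_cong P"
| trans: "(W, U) \<in> word_cong P \<Longrightarrow> (U, V) \<in> word_cong P \<Longrightarrow> (W, V) \<in> word_cong P"
| mult: "(W, W') \<in> word_cong P \<Longrightarrow> (U, U') \<in> word_cong P \<Longrightarrow> (W @ U, W' @ U') \<in> word_cong P"

definition word_class :: "'a presentation \<Rightarrow> 'a list \<Rightarrow> 'a list set" where
  "word_class P W = word_cong P `` {W}"

definition presented_monoid :: "'a presentation \<Rightarrow> 'a list set monoid" where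
  "presented_monoid P =
    \<lparr>carrier = UNIV // word_cong P,
     monoid.mult = (\<lambda>A B. \<Union>W\<in>A. \<Union>U\<in>B. word_class P (W @ U)),
     one = word_class P []\<rparr>"

lemma equiv_word_cong: "equiv UNIV (word_cong P)"
proof (rule equivI)
  show "refl (word_cong P)"
    by (rule refl_onI) (rule word_cong.refl)
  show "sym (word_cong P)"
    by (rule symI) (rule word_cong.sym)
  show "trans (word_cong P)"
    by (rule transI) (rule word_cong.trans)
qed simp

lemma word_class_eq_iff: "word_class P W = word_class P U \<longleftrightarrow> (W, U) \<in> word_cong P"
  unfolding word_class_def using equiv_word_cong[of P] by (simp add: eq_equiv_class_iff)

lemma carrier_presented_monoid: "carrier (presented_monoid P) = range (word_class P)"
  by (auto simp: presented_monoid_def word_class_def quotient_def)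

lemma one_presented_monoid: "\<one>\<^bsub>presented_monoid P\<^esub> = word_class P []"
  by (simp add: presented_monoid_def)

lemma mult_word_class:
  "word_class P W \<otimes>\<^bsub>presented_monoid P\<^esub> word_class P U = word_class P (W @ U)"
proof -
  have eq: "word_class P (W' @ U') = word_class P (W @ U)"
    if "W' \<in> word_class P W" "U' \<in> word_class P U" for W' U'
  proof -
    have "(W, W') \<in> word_cong P" "(U, U') \<in> word_cong P"
      using that by (simp_all add: word_class_def)
    then have "(W @ U, W' @ U') \<in> word_cong P"
      by (rule word_cong.mult)
    then show ?thesis
      unfolding word_class_eq_iff by (rule word_cong.sym)
  qed
  have W: "W \<in> word_class P W" and U: "U \<in> word_class P U"
    by (simp_all add: word_class_def word_cong.refl)
  have "word_class P W \<otimes>\<^bsub>presented_monoid P\<^esub> word_class P U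
      = (\<Union>W'\<in>word_class P W. \<Union>U'\<in>word_class P U. word_class P (W' @ U'))"
    by (simp add: presented_monoid_def)
  also have "\<dots> = (\<Union>W'\<in>word_class P W. \<Union>U'\<in>word_class P U. word_class P (W @ U))"
    by (intro SUP_cong HOL.refl eq)
  also have "\<dots> = word_class P (W @ U)"
    using W U by blast
  finally show ?thesis .
qed

lemma monoid_presented_monoid: "Group.monoid (presented_monoid P)"
proof (rule monoidI)
qed (force simp: carrier_presented_monoid one_presented_monoid mult_word_class)+

definition geodesic :: "'a presentation \<Rightarrow> 'a list \<Rightarrow> bool" where
  "geodesic P W \<longleftrightarrow> (\<forall>U. word_class P U = word_class P W \<longrightarrow> length W \<le> length U)"

definition defining_words :: "'a presentation \<Rightarrow> 'a list set" where
  "defining_words P = fst ` set P \<union> snd ` set P"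

definition piece :: "'a presentation \<Rightarrow> 'a list \<Rightarrow> bool" where
  "piece P W \<longleftrightarrow> (\<exists>W1\<in>defining_words P. \<exists>W2\<in>defining_words P. \<exists>U1 U2 V1 V2.
     W1 = U1 @ W @ U2 \<and> W2 = V1 @ W @ V2 \<and> (U1 \<noteq> V1 \<or> U2 \<noteq> V2))"

text \<open>The infimum of the empty set in \<^typ>\<open>enat\<close> is \<open>\<infinity>\<close>.\<close>

definition piece_length :: "'a presentation \<Rightarrow> 'a list \<Rightarrow> enat" where
  "piece_length P W = Inf {enat (length Ps) | Ps. W = concat Ps \<and> (\<forall>Q\<in>set Ps. piece P Q)}"

definition condition_K32 :: "'a presentation \<Rightarrow> bool" where
  "condition_K32 P \<longleftrightarrow>
    (\<forall>(L, R)\<in>set P. L \<noteq> [] \<and> R \<noteq> [] \<and> hd L \<noteq> hd R \<and> last L \<noteq> last R) \<and>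
    (\<forall>W\<in>defining_words P. piece_length P W \<ge> 3) \<and>
    (\<forall>i<length P. \<forall>j<length P. i \<noteq> j \<longrightarrow>
       distinct [snd (P ! i), fst (P ! i), snd (P ! j), fst (P ! j)])"

text \<open>
  \<open>L\<close> is a set of words over the alphabet \<open>A\<close> recognised by a finite deterministic automaton;
  its states may be taken to be natural numbers.
\<close>

definition regular_language :: "'b set \<Rightarrow> 'b list set \<Rightarrow> bool" where
  "regular_language A L \<longleftrightarrow>
    (\<exists>(Q :: nat set) (q0 :: nat) (F :: nat set) (d :: nat \<Rightarrow> 'b \<Rightarrow> nat).
       finite Q \<and> q0 \<in> Q \<and> F \<subseteq> Q \<and> (\<forall>q\<in>Q. \<forall>x\<in>A. d q x \<in> Q) \<and>
       L = {W \<in> lists A. foldl d q0 W \<in> F})"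

text \<open>The padding symbol \<open>$\<close> is \<^const>\<open>None\<close>.\<close>

definition padded_alphabet :: "('a option \<times> 'a option) set" where
  "padded_alphabet = UNIV - {(None, None)}"

fun pad_pair :: "'a list \<Rightarrow> 'a list \<Rightarrow> ('a option \<times> 'a option) list" where
  "pad_pair [] [] = []"
| "pad_pair (x # W) [] = (Some x, None) # pad_pair W []"
| "pad_pair [] (y # U) = (None, Some y) # pad_pair [] U"
| "pad_pair (x # W) (y # U) = (Some x, Some y) # pad_pair W U"

definition automatic_structure :: "'a presentation \<Rightarrow> 'a list set \<Rightarrow> bool" where
  "automatic_structure P L \<longleftrightarrow>
    regular_language UNIV L \<and>
    word_class P ` L = carrier (presented_monoid P) \<and>
    (\<forall>x\<in>insert [] (range (\<lambda>y. [y])).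
       regular_language padded_alphabet
         {pad_pair W U | W U. W \<in> L \<and> U \<in> L \<and> word_class P (W @ x) = word_class P U})"

datatype gen = gen_a | gen_b | gen_c

abbreviation word_abcc :: "gen list" where
  "word_abcc \<equiv> [gen_a, gen_b, gen_c, gen_c]"

abbreviation word_cba :: "gen list" where
  "word_cba \<equiv> [gen_c, gen_b, gen_a]"

definition abcc_cba :: "gen presentation" where
  "abcc_cba = [(word_abcc, word_cba)]"

end

(* The rewriting rule abcc -> cba shortens words and has no overlaps with itself, so every element of S
   has exactly one geodesic, its normal form.  A set of geodesics mapping onto S therefore contains
   (abc)^n and c(ba)^n for all n, and (abc)^n c = c(ba)^n in S.  Since |c(ba)^n| = 2n + 1, the padded
   pair of these words ends in a long power of the block (abc paired with padding), and deleting copies of this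
   block by a pumping argument changes the number of a's on one side only, although this number is
   invariant under the relation. *)
theory Submission
  imports Defs
begin

section \<open>Pumping in regular languages\<close>

text \<open>The bound \<open>m\<close> is the number of states: among the states reached after 0,
  ..., \<open>m\<close> copies of \<open>Y\<close> two coincide, and the loop between them can be
  cut out.\<close>

lemma regular_language_pump_down:
  assumes "regular_language A K"
  shows "\<exists>m. \<forall>X Y. X @ concat (replicate m Y) \<in> K \<longrightarrow>
           (\<exists>i<m. X @ concat (replicate i Y) \<in> K)"
proof -
  obtain Q F :: "nat set" and q0 d where Q: "finite Q" "q0 \<in> Q" "\<forall>q\<in>Q. \<forall>x\<in>A. d q x \<in> Q"
    and K: "K = {W \<in> lists A. foldl d q0 W \<in> F}"
    using assms unfolding regular_language_def by blast
  have run: "foldl d q W \<in> Q" if "q \<in> Q" "W \<in> lists A" for q W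
    using that Q(3) by (induction W arbitrary: q) auto
  have "\<exists>i<card Q. X @ concat (replicate i Y) \<in> K"
    if in_K: "X @ concat (replicate (card Q) Y) \<in> K" for X Y
  proof -
    \<comment> \<open>This makes \<open>Y\<close> actually occur in the given word, so that its
      letters lie in \<open>A\<close>.\<close>
    have "card Q \<noteq> 0"
      using Q by auto
    with in_K K have XY: "X \<in> lists A" "Y \<in> lists A"
      by auto
    have power: "concat (replicate k Y) \<in> lists A" for k
      using XY by (induction k) auto
    define st where "st k = foldl d q0 (X @ concat (replicate k Y))" for k
    have XY_power: "X @ concat (replicate k Y) \<in> lists A" for k
      using XY(1) power[of k] by simp
    have "st ` {..card Q} \<subseteq> Q"
      using run[OF Q(2) XY_power] unfolding st_def by blast
    from card_mono[OF Q(1) this] have "card (st ` {..card Q}) < card {..card Q}"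
      by simp
    then have "\<not> inj_on st {..card Q}"
      by (rule pigeonhole)
    then obtain i j where ij: "i < j" "j \<le> card Q" "st i = st j"
      unfolding inj_on_def by (metis atMost_iff linorder_neqE_nat)
    \<comment> \<open>The copies after the \<open>j\<close>-th are replayed from the equal state
      \<open>st i\<close>.\<close>
    define i' where "i' = i + (card Q - j)"
    have split: "st (u + v) = foldl d (st u) (concat (replicate v Y))" for u v
      by (simp add: st_def replicate_add)
    have "st i' = st (j + (card Q - j))"
      by (simp only: i'_def split ij(3))
    then have "foldl d q0 (X @ concat (replicate i' Y)) \<in> F"
      using in_K K ij(2) by (simp add: st_def)
    moreover have "i' < card Q"
      using ij by (simp add: i'_def)
    ultimately show ?thesis
      using K XY_power by blast
  qed
  then show ?thesis
    by blast
qed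

section \<open>Padded pairs of words\<close>

lemma map_filter_fst_pad_pair: "List.map_filter fst (pad_pair W U) = W"
  by (induction W U rule: pad_pair.induct) (auto simp: List.map_filter_def)

lemma map_filter_snd_pad_pair: "List.map_filter snd (pad_pair W U) = U"
  by (induction W U rule: pad_pair.induct) (auto simp: List.map_filter_def)

lemma pad_pair_inject: "pad_pair W U = pad_pair W' U' \<longleftrightarrow> W = W' \<and> U = U'"
  by (metis map_filter_fst_pad_pair map_filter_snd_pad_pair)

lemma pad_pair_Nil_right: "pad_pair W [] = map (\<lambda>x. (Some x, None)) W"
  by (induction W) auto

lemma pad_pair_append_left:
  "length U \<le> length W \<Longrightarrow> pad_pair (W @ V) U = pad_pair W U @ map (\<lambda>x. (Some x, None)) V"
  by (induction W U rule: pad_pair.induct) (auto simp: pad_pair_Nil_right)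

section \<open>Pieces of the defining words\<close>

text \<open>The factors ab, bc, cc, cb, ba are pairwise different, so two adjacent letters determine
  both the defining word and their position in it. Hence no piece has two letters.\<close>

lemma abcc_cba_factor_cases:
  assumes "W \<in> defining_words abcc_cba" "W = U @ x # y # V"
  shows "(U, x, y, W) \<in> {([], gen_a, gen_b, word_abcc), ([gen_a], gen_b, gen_c, word_abcc),
           ([gen_a, gen_b], gen_c, gen_c, word_abcc),
           ([], gen_c, gen_b, word_cba), ([gen_c], gen_b, gen_a, word_cba)}"
proof -
  have "W = word_abcc \<or> W = word_cba"
    using assms(1) by (auto simp: defining_words_def abcc_cba_def)
  then show ?thesis
    using assms(2) by (elim disjE) (auto simp: Cons_eq_append_conv)
qed

lemma piece_abcc_cba_length:
  assumes "piece abcc_cba W"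
  shows "length W \<le> 1"
proof (rule ccontr)
  assume "\<not> length W \<le> 1"
  then obtain x y V where W: "W = x # y # V"
    by (cases W; cases "tl W") auto
  obtain W1 W2 U1 U2 V1 V2 where mem: "W1 \<in> defining_words abcc_cba" "W2 \<in> defining_words abcc_cba"
    and eq: "W1 = U1 @ W @ U2" "W2 = V1 @ W @ V2" and neq: "U1 \<noteq> V1 \<or> U2 \<noteq> V2"
    using assms unfolding piece_def by blast
  have "W1 = U1 @ x # y # (V @ U2)" "W2 = V1 @ x # y # (V @ V2)"
    using eq W by simp_all
  from abcc_cba_factor_cases[OF mem(1) this(1)] abcc_cba_factor_cases[OF mem(2) this(2)]
  have "U1 = V1 \<and> W1 = W2"
    by auto
  with eq neq show False
    by simp
qed

lemma piece_length_abcc_cba: "enat (length W) \<le> piece_length abcc_cba W"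
  unfolding piece_length_def
proof (rule Inf_greatest)
  fix k
  assume "k \<in> {enat (length Ps) |Ps. W = concat Ps \<and> (\<forall>Q\<in>set Ps. piece abcc_cba Q)}"
  then obtain Ps where k: "k = enat (length Ps)" and W: "W = concat Ps"
    and Ps: "\<forall>Q\<in>set Ps. length Q \<le> 1"
    using piece_abcc_cba_length by blast
  have "length (concat Ps) \<le> length Ps"
    using Ps by (induction Ps) auto
  then show "enat (length W) \<le> k"
    by (simp add: k W)
qed

section \<open>Normal forms computed on a stack\<close>

text \<open>
  Irreducible words are kept as stacks, that is, reversed: the top of the stack is the last letter.
\<close>

fun push_c :: "gen list \<Rightarrow> gen list" where
  "push_c (gen_c # gen_b # gen_a # s) = gen_a # gen_b # push_c s"
| "push_c s = gen_c # s"

definition push :: "gen \<Rightarrow> gen list \<Rightarrow> gen list" where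
  "push x s = (if x = gen_c then push_c s else x # s)"

abbreviation normal_stack :: "gen list \<Rightarrow> gen list" where
  "normal_stack W \<equiv> fold push W []"

text \<open>On any stack \<open>s\<close>, pushing a, b, c, c and pushing c, b, a both end in
  \<open>gen_a # gen_b # push_c s\<close>.\<close>

lemma fold_push_cong:
  "(W, U) \<in> word_cong abcc_cba \<Longrightarrow> fold push W = fold push U"
  by (induction rule: word_cong.induct) (auto simp: abcc_cba_def push_def fun_eq_iff)

text \<open>Each side of the relation contains exactly one a.\<close>

lemma count_list_cong:
  assumes "(W, U) \<in> word_cong abcc_cba"
  shows "count_list W gen_a = count_list U gen_a"
  using assms by (induction rule: word_cong.induct) (auto simp: abcc_cba_def)

text \<open>One use of the relation moves the c to the left of ba, next to \<open>rev s\<close>,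
  where the induction hypothesis takes over.\<close>

lemma word_cong_push_c: "(rev s @ [gen_c], rev (push_c s)) \<in> word_cong abcc_cba"
proof (induction s rule: push_c.induct)
  case (1 s)
  have "(word_abcc, word_cba) \<in> word_cong abcc_cba"
    by (rule word_cong.base) (simp add: abcc_cba_def)
  from word_cong.mult[OF word_cong.refl[of "rev s"] this]
  have "(rev s @ word_abcc, (rev s @ [gen_c]) @ [gen_b, gen_a]) \<in> word_cong abcc_cba"
    by simp
  moreover from word_cong.mult[OF 1 word_cong.refl[of "[gen_b, gen_a]"]]
  have "((rev s @ [gen_c]) @ [gen_b, gen_a], rev (push_c s) @ [gen_b, gen_a])
      \<in> word_cong abcc_cba" .
  ultimately have "(rev s @ word_abcc, rev (push_c s) @ [gen_b, gen_a]) \<in> word_cong abcc_cba"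
    by (rule word_cong.trans)
  then show ?case
    by simp
qed (simp_all add: word_cong.refl)

lemma word_cong_push: "(rev s @ [x], rev (push x s)) \<in> word_cong abcc_cba"
  by (simp add: push_def word_cong_push_c word_cong.refl)

lemma word_cong_fold_push: "(rev s @ W, rev (fold push W s)) \<in> word_cong abcc_cba"
proof (induction W arbitrary: s)
  case Nil
  show ?case
    by (simp add: word_cong.refl)
next
  case (Cons x W)
  from word_cong.mult[OF word_cong_push[of s x] word_cong.refl[of W]]
  have "(rev s @ x # W, rev (push x s) @ W) \<in> word_cong abcc_cba"
    by simp
  from word_cong.trans[OF this Cons[of "push x s"]] show ?case
    by simp
qed

lemma word_class_eq_iff_normal_stack:
  "word_class abcc_cba W = word_class abcc_cba U \<longleftrightarrow> normal_stack W = normal_stack U"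
proof
  assume "word_class abcc_cba W = word_class abcc_cba U"
  then show "normal_stack W = normal_stack U"
    using fold_push_cong by (simp add: word_class_eq_iff)
next
  assume "normal_stack W = normal_stack U"
  then show "word_class abcc_cba W = word_class abcc_cba U"
    unfolding word_class_eq_iff using word_cong_fold_push[of "[]"]
    by (metis append_Nil rev.simps(1) word_cong.sym word_cong.trans)
qed

section \<open>Geodesics are normal forms\<close>

text \<open>Every rewriting of abcc to cba loses one letter, which at least makes up for the pushed
  c.\<close>

lemma push_c_shortens: "push_c s = gen_c # s \<or> length (push_c s) \<le> length s"
  by (induction s rule: push_c.induct) auto

lemma fold_push_shortens:
  "fold push W s = rev W @ s \<or> length (fold push W s) < length W + length s"
proof (induction W arbitrary: s)
  case (Cons x W)
  have "push x s = x # s \<or> length (push x s) \<le> length s"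
    using push_c_shortens by (auto simp: push_def)
  with Cons[of "push x s"] show ?case
    by auto
qed simp

text \<open>Reading the stack backwards gives an equal word, and it would be shorter if any
  rewriting had occurred.\<close>

lemma normal_stack_geodesic:
  assumes "geodesic abcc_cba W"
  shows "normal_stack W = rev W"
proof -
  have "word_class abcc_cba (rev (normal_stack W)) = word_class abcc_cba W"
    unfolding word_class_eq_iff using word_cong_fold_push[of "[]" W] by (simp add: word_cong.sym)
  then have "length W \<le> length (rev (normal_stack W))"
    using assms unfolding geodesic_def by blast
  then show ?thesis
    using fold_push_shortens[of W "[]"] by simp
qed

text \<open>\<open>L\<close> meets the class of \<open>W\<close> in a geodesic, which is the normal
  form of that class and so equals \<open>W\<close>.\<close>

lemma normal_stack_mem:
  assumes "automatic_structure abcc_cba L" "\<forall>W\<in>L. geodesic abcc_cba W"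
    and "normal_stack W = rev W"
  shows "W \<in> L"
proof -
  have "word_class abcc_cba W \<in> word_class abcc_cba ` L"
    using assms(1) by (simp add: automatic_structure_def carrier_presented_monoid)
  then obtain U where U: "U \<in> L" "normal_stack W = normal_stack U"
    by (auto simp: word_class_eq_iff_normal_stack)
  then have "rev W = rev U"
    using assms normal_stack_geodesic by metis
  with U show ?thesis
    by simp
qed

section \<open>The words (abc)^n and c(ba)^n\<close>

abbreviation abc_power :: "nat \<Rightarrow> gen list" where
  "abc_power n \<equiv> concat (replicate n [gen_a, gen_b, gen_c])"

abbreviation c_ba_power :: "nat \<Rightarrow> gen list" where
  "c_ba_power n \<equiv> gen_c # concat (replicate n [gen_b, gen_a])"

lemma concat_replicate_snoc: "concat (replicate n xs) @ xs = xs @ concat (replicate n xs)"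
  by (induction n) auto

lemma rev_concat_replicate: "rev (concat (replicate n xs)) = concat (replicate n (rev xs))"
  by (induction n) (auto simp: concat_replicate_snoc)

text \<open>No rewriting takes place, since every c is pushed onto a b.\<close>

lemma fold_push_abc_power:
  "fold push (abc_power n) s = rev (abc_power n) @ s"
  by (induction n arbitrary: s) (auto simp: push_def)

lemma fold_push_ba_power:
  "fold push (concat (replicate n [gen_b, gen_a])) s = rev (concat (replicate n [gen_b, gen_a])) @ s"
  by (induction n arbitrary: s) (auto simp: push_def)

lemma normal_stack_c_ba_power: "normal_stack (c_ba_power n) = rev (c_ba_power n)"
  by (simp add: push_def fold_push_ba_power)

text \<open>A single c passes down through all \<open>n\<close> blocks and takes one letter from
  each.\<close>

lemma push_c_abc_power: "push_c (rev (abc_power n)) = rev (c_ba_power n)"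
  unfolding rev.simps rev_concat_replicate by (induction n) auto

lemma abc_power_times_c:
  "word_class abcc_cba (abc_power n @ [gen_c]) = word_class abcc_cba (c_ba_power n)"
proof -
  have "normal_stack (abc_power n @ [gen_c]) = push_c (rev (abc_power n))"
    by (simp add: fold_push_abc_power push_def)
  then show ?thesis
    by (simp only: word_class_eq_iff_normal_stack push_c_abc_power normal_stack_c_ba_power)
qed

lemma length_concat_replicate: "length (concat (replicate n xs)) = n * length xs"
  by (induction n) auto

lemma count_list_powers:
  "count_list (abc_power n) gen_a = n" "count_list (c_ba_power n) gen_a = n"
  by (induction n) auto

section \<open>The contradiction and the stated theorem\<close>

theorem no_geodesic_automatic_structure:
  assumes L: "automatic_structure abcc_cba L" "\<forall>W\<in>L. geodesic abcc_cba W"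
  shows False
proof -
  define K where "K = {pad_pair W U | W U. W \<in> L \<and> U \<in> L \<and>
    word_class abcc_cba (W @ [gen_c]) = word_class abcc_cba U}"
  define Y where "Y = map (\<lambda>x. (Some x, None :: gen option)) [gen_a, gen_b, gen_c]"
  have "regular_language padded_alphabet K"
    using L(1) unfolding automatic_structure_def K_def by blast
  then obtain m where m: "\<And>X Y. X @ concat (replicate m Y) \<in> K \<Longrightarrow>
      \<exists>i<m. X @ concat (replicate i Y) \<in> K"
    using regular_language_pump_down by blast
  \<comment> \<open>The prefix \<open>(abc)\<^sup>p\<close> is exactly as long as \<open>c(ba)\<^sup>p\<^sup>+\<^sup>m\<close>.\<close>
  define p where "p = 2 * m + 1"
  define U where "U = c_ba_power (p + m)"
  define X where "X = pad_pair (abc_power p) U"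
  have pad: "pad_pair (abc_power (p + i)) U = X @ concat (replicate i Y)" for i
  proof -
    have "length U \<le> length (abc_power p)"
      unfolding U_def by (simp add: length_concat_replicate p_def)
    from pad_pair_append_left[OF this, of "abc_power i"] show ?thesis
      by (simp add: replicate_add X_def Y_def map_concat)
  qed
  have "abc_power (p + m) \<in> L"
    by (rule normal_stack_mem[OF L]) (simp only: fold_push_abc_power append_Nil2)
  moreover have "U \<in> L"
    unfolding U_def by (rule normal_stack_mem[OF L normal_stack_c_ba_power])
  ultimately have "pad_pair (abc_power (p + m)) U \<in> K"
    using abc_power_times_c[of "p + m"] unfolding K_def U_def by blast
  then obtain i where i: "i < m" "pad_pair (abc_power (p + i)) U \<in> K"
    using m unfolding pad by blast
  then have "word_class abcc_cba (abc_power (p + i) @ [gen_c]) = word_class abcc_cba U"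
    unfolding K_def mem_Collect_eq pad_pair_inject by blast
  \<comment> \<open>Pumping left \<open>U\<close> with its \<open>p + m\<close> letters a, while the
    other side now has only \<open>p + i\<close>.\<close>
  then have "count_list (abc_power (p + i) @ [gen_c]) gen_a = count_list U gen_a"
    unfolding word_class_eq_iff by (rule count_list_cong)
  then have "p + i = p + m"
    unfolding U_def count_list_append count_list_powers by simp
  with i(1) show False
    by simp
qed

theorem mainTheorem2:
  shows "condition_K32 abcc_cba \<and>
    piece_length abcc_cba word_abcc + piece_length abcc_cba word_cba \<ge> 7 \<and>
    \<not> (\<exists>L. automatic_structure abcc_cba L \<and> (\<forall>W\<in>L. geodesic abcc_cba W)) \<and>
    \<not> automatic_structure abcc_cba {W. geodesic abcc_cba W}"
proof -
  \<comment> \<open>As pieces have at most one letter, the bounds are the word lengths.\<close>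
  have abcc: "4 \<le> piece_length abcc_cba word_abcc" and cba: "3 \<le> piece_length abcc_cba word_cba"
    using piece_length_abcc_cba[of word_abcc] piece_length_abcc_cba[of word_cba]
    by (simp_all add: numeral_eq_enat eval_nat_numeral)
  have "3 \<le> piece_length abcc_cba word_abcc"
    by (rule order_trans[OF _ abcc]) simp
  with cba have "condition_K32 abcc_cba"
    unfolding condition_K32_def defining_words_def by (simp add: abcc_cba_def)
  moreover have "7 \<le> piece_length abcc_cba word_abcc + piece_length abcc_cba word_cba"
    using add_mono[OF abcc cba] by simp
  ultimately show ?thesis
    \<comment> \<open>The set of all geodesics is one of the languages \<open>L\<close> already
      excluded.\<close>
    using no_geodesic_automatic_structure by blast
qed

end
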